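(* Let $p,q\ge 1$ be integers. Every linear self map of $D_{p,q}$ has at least one fixed point in $\overline{D_{p,q}}:=D_{p,q}\cup\partial D_{p,q}$.
   Context: $H_{p,q}=\begin{pmatrix}I_p&0\\0&-I_q\end{pmatrix}$ and $\cdot^H$ is the Hermitian (conjugate) transpose. The generalized ball is $D_{p,q}=\{[z]\in\mathbb P^{p+q-1}: z^HH_{p,q}z>0\}$, with boundary $\partial D_{p,q}=\{[z]: z^HH_{p,q}z=0\}$. A linear self map of $D_{p,q}$ is a map $D_{p,q}\to D_{p,q}$ of the form $[z]\mapsto[Az]$ for some complex $(p+q)\times(p+q)$ matrix $A$ (not necessarily invertible; well-definedness requires $Az\ne0$ whenever $z^HH_{p,q}z>0$); $A$ is called a matrix representation of the map. The fixed points of such a map, including those on $\partial D_{p,q}$, are the points $[v]$ where $v$ is an eigenvector of $A$ associated to a non-zero eigenvalue. *)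

theory Defs
  imports "Jordan_Normal_Form.Char_Poly"
begin

text \<open>
  The projective point \<open>[z]\<close> is encoded as the set of all non-zero multiples of \<open>z\<close>;
  it is only used for non-zero \<open>z\<close>.
\<close>

definition proj_pt :: "complex vec \<Rightarrow> complex vec set" where
  "proj_pt z = {c \<cdot>\<^sub>v z | c. c \<noteq> 0}"

definition H_mat :: "nat \<Rightarrow> nat \<Rightarrow> complex mat" where
  "H_mat p q = four_block_mat (1\<^sub>m p) (0\<^sub>m p q) (0\<^sub>m q p) (- 1\<^sub>m q)"

definition H_form :: "nat \<Rightarrow> nat \<Rightarrow> complex vec \<Rightarrow> complex" where
  "H_form p q z = conjugate z \<bullet> (H_mat p q *\<^sub>v z)"

text \<open>
  The value of \<open>H_form\<close> is real (\<open>H_form_real\<close> below). The order on \<^typ>\<open>complex\<close> is the one of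
  \<open>HOL-Library.Complex_Order\<close>, in which \<open>0 < w\<close> means that \<open>w\<close> is real and positive.
\<close>

definition gen_ball :: "nat \<Rightarrow> nat \<Rightarrow> complex vec set set" where
  "gen_ball p q = {proj_pt z | z. z \<in> carrier_vec (p + q) \<and> z \<noteq> 0\<^sub>v (p + q) \<and> 0 < H_form p q z}"

definition gen_ball_boundary :: "nat \<Rightarrow> nat \<Rightarrow> complex vec set set" where
  "gen_ball_boundary p q =
     {proj_pt z | z. z \<in> carrier_vec (p + q) \<and> z \<noteq> 0\<^sub>v (p + q) \<and> H_form p q z = 0}"

definition closed_gen_ball :: "nat \<Rightarrow> nat \<Rightarrow> complex vec set set" where
  "closed_gen_ball p q = gen_ball p q \<union> gen_ball_boundary p q"

definition matrix_representation ::
    "nat \<Rightarrow> nat \<Rightarrow> complex mat \<Rightarrow> (complex vec set \<Rightarrow> complex vec set) \<Rightarrow> bool" where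
  "matrix_representation p q A f \<longleftrightarrow>
     A \<in> carrier_mat (p + q) (p + q) \<and>
     (\<forall>z \<in> carrier_vec (p + q). 0 < H_form p q z \<longrightarrow>
        A *\<^sub>v z \<noteq> 0\<^sub>v (p + q) \<and> f (proj_pt z) = proj_pt (A *\<^sub>v z))"

text \<open>Only the values of \<open>f\<close> on \<open>gen_ball p q\<close> are relevant.\<close>

definition linear_self_map ::
    "nat \<Rightarrow> nat \<Rightarrow> (complex vec set \<Rightarrow> complex vec set) \<Rightarrow> bool" where
  "linear_self_map p q f \<longleftrightarrow>
     f ` gen_ball p q \<subseteq> gen_ball p q \<and> (\<exists>A. matrix_representation p q A f)"

text \<open>
  The fixed points of the map represented by \<open>A\<close>. They may lie anywhere in the projective space,
  in particular outside the domain \<open>gen_ball p q\<close> of the map.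
\<close>

definition fixed_points :: "complex mat \<Rightarrow> complex vec set set" where
  "fixed_points A = {proj_pt v | v. \<exists>k. eigenvector A v k \<and> k \<noteq> 0}"


text \<open>The form is real-valued, and its sign depends only on the projective point.\<close>

lemma H_mat_carrier: "H_mat p q \<in> carrier_mat (p + q) (p + q)"
  unfolding H_mat_def by auto

lemma H_form_sum:
  assumes z: "z \<in> carrier_vec (p + q)"
  shows "H_form p q z =
    of_real ((\<Sum>i<p. (cmod (z $ i))\<^sup>2) - (\<Sum>i\<in>{p..<p+q}. (cmod (z $ i))\<^sup>2))"
proof -
  have row: "(H_mat p q *\<^sub>v z) $ i = (if i < p then z $ i else - (z $ i))"
    if i: "i < p + q" for i
  proof -
    have e: "H_mat p q $$ (i, j) = (if i = j then (if i < p then 1 else -1) else 0)"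
      if "j < p + q" for j
      using i that unfolding H_mat_def by auto
    have "(H_mat p q *\<^sub>v z) $ i = (\<Sum>j = 0..<p + q. H_mat p q $$ (i, j) * z $ j)"
      using i z H_mat_carrier[of p q] by (auto simp: scalar_prod_def)
    also have "\<dots> = (\<Sum>j = 0..<p + q. if i = j then (if i < p then 1 else -1) * z $ j else 0)"
      by (rule sum.cong) (auto simp: e)
    finally show ?thesis using i by auto
  qed
  have "H_form p q z = (\<Sum>i = 0..<p + q. cnj (z $ i) * (H_mat p q *\<^sub>v z) $ i)"
    using z H_mat_carrier[of p q] unfolding H_form_def by (simp add: scalar_prod_def)
  also have "\<dots> = (\<Sum>i = 0..<p + q.
      if i < p then of_real ((cmod (z $ i))\<^sup>2) else - of_real ((cmod (z $ i))\<^sup>2))"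
  proof (rule sum.cong, simp)
    fix i assume "i \<in> {0..<p + q}"
    then show "cnj (z $ i) * (H_mat p q *\<^sub>v z) $ i =
        (if i < p then of_real ((cmod (z $ i))\<^sup>2) else - of_real ((cmod (z $ i))\<^sup>2))"
      by (simp add: row complex_norm_square mult.commute del: of_real_power)
  qed
  also have "\<dots> = (\<Sum>i\<in>{..<p} \<union> {p..<p + q}.
      if i < p then of_real ((cmod (z $ i))\<^sup>2) else - of_real ((cmod (z $ i))\<^sup>2))"
    by (rule sum.cong) auto
  also have "\<dots> = (\<Sum>i<p. of_real ((cmod (z $ i))\<^sup>2))
      + (\<Sum>i\<in>{p..<p + q}. - of_real ((cmod (z $ i))\<^sup>2))"
    by (subst sum.union_disjoint) (auto intro!: arg_cong2[of _ _ _ _ "(+)"] sum.cong)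
  finally show ?thesis
    by (simp add: sum_negf del: of_real_power)
qed

lemma H_form_real: "z \<in> carrier_vec (p + q) \<Longrightarrow> H_form p q z \<in> \<real>"
  by (simp add: H_form_sum del: of_real_diff)

lemma H_form_smult:
  "z \<in> carrier_vec (p + q) \<Longrightarrow> H_form p q (c \<cdot>\<^sub>v z) = of_real ((cmod c)\<^sup>2) * H_form p q z"
  using H_mat_carrier[of p q] unfolding H_form_def
  by (simp add: conjugate_smult_vec mult_mat_vec complex_norm_square mult.assoc
      del: of_real_power)

lemma proj_pt_in_gen_ball:
  assumes "z \<in> carrier_vec (p + q)" "z \<noteq> 0\<^sub>v (p + q)"
  shows "proj_pt z \<in> gen_ball p q \<longleftrightarrow> 0 < H_form p q z"
proof
  assume "proj_pt z \<in> gen_ball p q"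
  then obtain w where w: "proj_pt z = proj_pt w" "w \<in> carrier_vec (p + q)" "0 < H_form p q w"
    unfolding gen_ball_def by blast
  have "z = 1 \<cdot>\<^sub>v z" by simp
  then have "z \<in> proj_pt z" unfolding proj_pt_def mem_Collect_eq
    by (intro exI[of _ 1] conjI) simp_all
  then have "z \<in> {c \<cdot>\<^sub>v w | c. c \<noteq> 0}"
    unfolding w(1) by (simp only: proj_pt_def)
  then obtain c where c: "c \<noteq> 0" "z = c \<cdot>\<^sub>v w" by (elim CollectE exE conjE)
  show "0 < H_form p q z"
    unfolding c(2) H_form_smult[OF w(2)] using c(1) w(3) by (simp add: less_complex_def)
next
  assume "0 < H_form p q z"
  then show "proj_pt z \<in> gen_ball p q"
    unfolding gen_ball_def mem_Collect_eq using assms by (intro exI[of _ z] conjI) simp_all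
qed

end

theory Submission
  imports
    Defs
    "Jordan_Normal_Form.Jordan_Normal_Form_Existence"
    "HOL-Real_Asymp.Real_Asymp"
begin

text \<open>
  Start from a positive vector \<open>z\<close>. All \<open>A\<^sup>m z\<close> are positive, and by the Jordan normal form
  \<open>A\<^sup>m z\<close> is a combination of the terms \<open>(m choose l) b\<^bsup>m-l\<^esup> w\<^bsub>b,l\<^esub>\<close>, where \<open>b\<close> runs through
  the non-zero eigenvalues (for \<open>m\<close> large) and \<open>A w\<^bsub>b,l\<^esub> = b w\<^bsub>b,l\<^esub> + w\<^bsub>b,l+1\<^esub>\<close>. Divide by the largest growth rate
  \<open>(m choose k) r\<^sup>m\<close>. What survives is a sum of eigenvectors with distinct eigenvalues of modulus
  \<open>r > 0\<close>, each rotating with its own phase. In the Cesaro mean over \<open>m\<close> of the values of the form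
  the cross terms disappear, so a positive combination of the values of the form at these
  eigenvectors is non-negative; hence one of these values is non-negative.
\<close>

section \<open>Cesaro means and the orthogonality of distinct phases\<close>

definition cesaro_mean :: "(nat \<Rightarrow> complex) \<Rightarrow> nat \<Rightarrow> complex" where
  "cesaro_mean f n = (\<Sum>m<n. f m) / of_nat n"

lemma cesaro_mean_null:
  assumes "f \<longlonglongrightarrow> 0"
  shows "cesaro_mean f \<longlonglongrightarrow> 0"
proof (rule LIMSEQ_I)
  fix e :: real assume e: "e > 0"
  obtain N where N: "\<And>m. m \<ge> N \<Longrightarrow> norm (f m) < e / 2"
    using LIMSEQ_D[OF assms, of "e / 2"] e by auto
  define S where "S = (\<Sum>m<N. norm (f m))"
  \<comment> \<open>Once \<open>n\<close> exceeds \<open>M\<close>, the fixed contribution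
    \<open>S\<close> of the first \<open>N\<close> terms is less than half of \<open>n * e\<close>;
    the tail supplies the other half.\<close>
  obtain M :: nat where M: "M > 2 * S / e" using reals_Archimedean2 by blast
  show "\<exists>n0. \<forall>n\<ge>n0. norm (cesaro_mean f n - 0) < e"
  proof (intro exI[of _ "max (Suc M) N"] allI impI)
    fix n assume n: "n \<ge> max (Suc M) N"
    have "norm (\<Sum>m<n. f m) \<le> (\<Sum>m<n. norm (f m))" by (rule norm_sum)
    also have "\<dots> = S + (\<Sum>m\<in>{N..<n}. norm (f m))"
      unfolding S_def lessThan_atLeast0 using n by (intro sum.atLeastLessThan_concat[symmetric]) auto
    also have "(\<Sum>m\<in>{N..<n}. norm (f m)) \<le> of_nat (card {N..<n}) * (e / 2)"
      using N by (intro sum_bounded_above) (auto intro: less_imp_le)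
    also have "\<dots> \<le> of_nat n * (e / 2)" using e by (intro mult_right_mono) auto
    also have "S < of_nat n * (e / 2)"
    proof -
      have "2 * S / e < of_nat n" using M n by linarith
      then show ?thesis using e by (simp add: field_simps)
    qed
    finally have "norm (\<Sum>m<n. f m) < of_nat n * e" by (simp add: field_simps)
    then show "norm (cesaro_mean f n - 0) < e"
      using n by (simp add: cesaro_mean_def norm_divide field_simps)
  qed
qed

lemma cesaro_mean_sum:
  "cesaro_mean (\<lambda>m. \<Sum>i\<in>I. f i m) = (\<lambda>n. \<Sum>i\<in>I. cesaro_mean (f i) n)"
  unfolding cesaro_mean_def
  by (rule ext, subst sum.swap) (simp add: sum_divide_distrib)

lemma cesaro_mean_add:
  "cesaro_mean (\<lambda>m. f m + g m) = (\<lambda>n. cesaro_mean f n + cesaro_mean g n)"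
  unfolding cesaro_mean_def by (simp add: sum.distrib add_divide_distrib)

lemma cesaro_mean_cmult:
  "cesaro_mean (\<lambda>m. c * f m) = (\<lambda>n. c * cesaro_mean f n)"
  unfolding cesaro_mean_def by (simp add: sum_distrib_left)

text \<open>For \<open>w\<close> on the unit circle other than 1 the partial sums of the geometric
  series stay bounded by \<open>2 / norm (w - 1)\<close>, so dividing by \<open>n\<close> sends them
  to 0.\<close>

lemma cesaro_mean_geometric:
  assumes "norm w = 1"
  shows "cesaro_mean (\<lambda>m. w ^ m) \<longlonglongrightarrow> (if w = 1 then 1 else 0)"
proof (cases "w = 1")
  case True
  \<comment> \<open>Only eventually: at \<open>n = 0\<close> the mean is 0 / 0, which is 0.\<close>
  have "\<forall>\<^sub>F n in sequentially. cesaro_mean (\<lambda>m. w ^ m) n = 1"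
    using eventually_gt_at_top[of 0] by eventually_elim (simp add: True cesaro_mean_def)
  then show ?thesis using True by (simp add: tendsto_eventually)
next
  case False
  have "cesaro_mean (\<lambda>m. w ^ m) \<longlonglongrightarrow> 0"
  proof (rule tendsto_norm_zero_cancel, rule tendsto_sandwich[OF _ _ tendsto_const])
    show "\<forall>\<^sub>F n in sequentially. norm (cesaro_mean (\<lambda>m. w ^ m) n) \<le> (2 / norm (w - 1)) / of_nat n"
    proof (intro always_eventually allI)
      fix n
      have "norm (\<Sum>m<n. w ^ m) = norm (w ^ n - 1) / norm (w - 1)"
        using geometric_sum[OF False, of n] by (simp add: norm_divide)
      also have "norm (w ^ n - 1) \<le> 2"
        using norm_triangle_ineq4[of "w ^ n" 1] assms by (simp add: norm_power)
      finally show "norm (cesaro_mean (\<lambda>m. w ^ m) n) \<le> (2 / norm (w - 1)) / of_nat n"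
        unfolding cesaro_mean_def norm_divide norm_of_nat
        by (simp only: divide_right_mono norm_ge_zero of_nat_0_le_iff)
    qed
    show "\<forall>\<^sub>F n in sequentially. 0 \<le> norm (cesaro_mean (\<lambda>m. w ^ m) n)" by simp
    show "(\<lambda>n. (2 / norm (w - 1)) / of_nat n) \<longlonglongrightarrow> 0"
      by (rule lim_const_over_n)
  qed
  then show ?thesis using False by simp
qed

text \<open>Up to a null sequence the product is a constant times the powers of
  \<open>v * cnj w\<close>, a number on the unit circle that equals 1 exactly when the phases
  agree.\<close>

lemma cesaro_mean_product:
  assumes a: "(\<lambda>m. a m - c * v ^ m) \<longlonglongrightarrow> 0" and b: "(\<lambda>m. b m - d * w ^ m) \<longlonglongrightarrow> 0"
    and v: "norm v = 1" and w: "norm w = 1"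
  shows "cesaro_mean (\<lambda>m. a m * cnj (b m)) \<longlonglongrightarrow> (if v = w then c * cnj d else 0)"
proof -
  define f where "f m = a m - c * v ^ m" for m
  define g where "g m = b m - d * w ^ m" for m
  define e where "e m = a m * cnj (b m) - c * cnj d * (v * cnj w) ^ m" for m
  have f: "(\<lambda>m. norm (f m)) \<longlonglongrightarrow> 0" and g: "(\<lambda>m. norm (g m)) \<longlonglongrightarrow> 0"
    using a b unfolding f_def g_def by (auto intro: tendsto_norm_zero)
  have "e \<longlonglongrightarrow> 0"
  proof (rule tendsto_norm_zero_cancel, rule tendsto_sandwich[OF _ _ tendsto_const])
    show "\<forall>\<^sub>F m in sequentially. norm (e m) \<le>
        norm (f m) * norm (g m) + norm (f m) * norm d + norm c * norm (g m)"
    proof (intro always_eventually allI)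
      fix m
      \<comment> \<open>After removal of the main term, every remaining product has a null factor
        \<open>f m\<close> or \<open>g m\<close>, and its other factors are bounded.\<close>
      have "e m = f m * cnj (g m) + f m * (cnj d * cnj w ^ m) + c * v ^ m * cnj (g m)"
        unfolding e_def f_def g_def by (simp add: algebra_simps power_mult_distrib)
      also have "norm \<dots> \<le> norm (f m * cnj (g m)) + norm (f m * (cnj d * cnj w ^ m))
          + norm (c * v ^ m * cnj (g m))"
        by (intro norm_triangle_le add_right_mono norm_triangle_ineq)
      finally show "norm (e m) \<le>
          norm (f m) * norm (g m) + norm (f m) * norm d + norm c * norm (g m)"
        by (simp add: norm_mult norm_power v w)
    qed
    show "\<forall>\<^sub>F m in sequentially. 0 \<le> norm (e m)" by simp
    show "(\<lambda>m. norm (f m) * norm (g m) + norm (f m) * norm d + norm c * norm (g m)) \<longlonglongrightarrow> 0"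
      using tendsto_add[OF tendsto_add[OF tendsto_mult[OF f g]
          tendsto_mult_right[OF f, of "norm d"]] tendsto_mult_left[OF g, of "norm c"]] by simp
  qed
  then have e: "cesaro_mean e \<longlonglongrightarrow> 0" by (rule cesaro_mean_null)
  have vw: "v * cnj w = 1 \<longleftrightarrow> v = w"
  proof
    assume "v * cnj w = 1"
    then have "v * (w * cnj w) = w" by (simp add: mult.left_commute)
    then show "v = w" using w by (simp add: complex_norm_square[symmetric])
  qed (use w in \<open>simp add: complex_norm_square[symmetric]\<close>)
  have "cesaro_mean (\<lambda>m. (v * cnj w) ^ m) \<longlonglongrightarrow> (if v * cnj w = 1 then 1 else 0)"
    by (rule cesaro_mean_geometric) (simp add: norm_mult v w)
  then have "(\<lambda>n. c * cnj d * cesaro_mean (\<lambda>m. (v * cnj w) ^ m) n + cesaro_mean e n)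
      \<longlonglongrightarrow> c * cnj d * (if v * cnj w = 1 then 1 else 0) + 0"
    by (intro tendsto_intros e)
  moreover have "cesaro_mean (\<lambda>m. a m * cnj (b m)) =
      cesaro_mean (\<lambda>m. c * cnj d * (v * cnj w) ^ m + e m)"
    unfolding e_def by simp
  ultimately show ?thesis
    unfolding cesaro_mean_add cesaro_mean_cmult vw by (simp split: if_splits)
qed

section \<open>Generalized eigenvectors from the Jordan normal form\<close>

text \<open>Entries linking two different blocks vanish, and within a block the diagonal is constant
  and only the superdiagonal is non-zero besides. The induction peels off the first block, of size
  \<open>k\<close>, and shifts the indices by \<open>k\<close>.\<close>

lemma jordan_matrix_entry_nonzero:
  assumes "i < dim_row (jordan_matrix n_as)" "j < dim_row (jordan_matrix n_as)"
    and "i \<noteq> j" "jordan_matrix n_as $$ (i, j) \<noteq> 0"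
  shows "Suc i = j \<and> jordan_matrix n_as $$ (i, i) = jordan_matrix n_as $$ (j, j)"
  using assms
proof (induction n_as arbitrary: i j)
  case Nil
  then show ?case by simp
next
  case (Cons na n_as)
  obtain k a where na: "na = (k, a)" by force
  let ?d = "dim_row (jordan_matrix n_as)"
  have idx: "jordan_matrix (na # n_as) $$ (i', j') =
      (if i' < k then if j' < k then jordan_block k a $$ (i', j') else 0
       else if j' < k then 0 else jordan_matrix n_as $$ (i' - k, j' - k))"
    if "i' < k + ?d" "j' < k + ?d" for i' j'
    using that unfolding na jordan_matrix_Cons by (subst index_mat_four_block) auto
  have ij: "i < k + ?d" "j < k + ?d" using Cons.prems by (auto simp: na)
  show ?case
  proof (cases "i < k")
    case True
    then show ?thesis
      using Cons.prems(3,4) unfolding idx[OF ij] idx[OF ij(1) ij(1)] idx[OF ij(2) ij(2)]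
      by (auto split: if_splits)
  next
    case False
    then have jk: "\<not> j < k" using Cons.prems(4) unfolding idx[OF ij] by (auto split: if_splits)
    have "Suc (i - k) = j - k \<and> jordan_matrix n_as $$ (i - k, i - k) = jordan_matrix n_as $$ (j - k, j - k)"
      using Cons.prems(3,4) False jk ij unfolding idx[OF ij] by (intro Cons.IH) auto
    then show ?thesis using False jk unfolding idx[OF ij(1) ij(1)] idx[OF ij(2) ij(2)] by auto
  qed
qed

text \<open>Here \<open>w k l\<close> is \<open>(A - k)\<close> applied \<open>l\<close> times to
  the component of \<open>z\<close> in the generalized eigenspace of \<open>k\<close>. Letting
  \<open>l\<close> run over all naturals, with zero vectors from \<open>n\<close> on, avoids
  recording the lengths of the chains; for \<open>k\<close> outside the spectrum all
  \<open>w k l\<close> are zero.\<close>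

lemma generalized_eigenvector_decomposition:
  fixes A :: "complex mat"
  assumes A: "A \<in> carrier_mat n n" and z: "z \<in> carrier_vec n"
  obtains S w where "finite S" "\<And>k l. w k l \<in> carrier_vec n"
    "\<And>k l. A *\<^sub>v w k l = k \<cdot>\<^sub>v w k l + w k (Suc l)"
    "\<And>k l. n \<le> l \<Longrightarrow> w k l = 0\<^sub>v n"
    "\<And>i. i < n \<Longrightarrow> z $ i = (\<Sum>k\<in>S. w k 0 $ i)"
proof -
  obtain n_as where "jordan_nf A n_as"
    using char_poly_factorized[OF A] jordan_nf_exists[OF A] by blast
  then obtain P Q where PQ: "similar_mat_wit A (jordan_matrix n_as) P Q"
    unfolding jordan_nf_def similar_mat_def by blast
  define J where "J = jordan_matrix n_as"
  have J: "J \<in> carrier_mat n n" and P: "P \<in> carrier_mat n n" and Q: "Q \<in> carrier_mat n n"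
    and PQ1: "P * Q = 1\<^sub>m n" and QP1: "Q * P = 1\<^sub>m n" and APJQ: "A = P * J * Q"
    using PQ A unfolding similar_mat_wit_def J_def Let_def by auto
  have AP: "A * P = P * J"
    unfolding APJQ using J P Q QP1 by (simp add: assoc_mult_mat[of _ n n _ n _ n])
  define y where "y = Q *\<^sub>v z"
  have y: "y \<in> carrier_vec n" unfolding y_def using Q z by simp
  have zPy: "z = P *\<^sub>v y"
    unfolding y_def using assoc_mult_mat_vec[OF P Q z] PQ1 z by simp
  \<comment> \<open>\<open>x k l\<close> is \<open>(J - k)\<^sup>l\<close> applied to the part of \<open>y\<close> supported on the blocks of eigenvalue \<open>k\<close>.\<close>
  define x where "x k = rec_nat (\<lambda>i. if i < n \<and> J $$ (i, i) = k then y $ i else 0)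
    (\<lambda>_ u i. if Suc i < n then J $$ (i, Suc i) * u (Suc i) else 0)" for k
  have x0: "x k 0 i = (if i < n \<and> J $$ (i, i) = k then y $ i else 0)" for k i
    unfolding x_def by simp
  have xS: "x k (Suc l) i = (if Suc i < n then J $$ (i, Suc i) * x k l (Suc i) else 0)" for k l i
    unfolding x_def by simp
  have entry: "Suc i = j \<and> J $$ (i, i) = J $$ (j, j)"
    if "i < n" "j < n" "i \<noteq> j" "J $$ (i, j) \<noteq> 0" for i j
    using that jordan_matrix_entry_nonzero[of i n_as j] J unfolding J_def by auto
  \<comment> \<open>Each application of \<open>J - k\<close> moves the support up by one index, so
    nothing is left after \<open>n\<close> steps. The eigenvalue is kept because a non-zero
    superdiagonal entry joins equal diagonal entries.\<close>
  have supp: "i + l < n \<and> J $$ (i, i) = k" if "x k l i \<noteq> 0" for k l i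
    using that
  proof (induction l arbitrary: i)
    case 0
    then show ?case by (auto simp: x0 split: if_splits)
  next
    case (Suc l)
    then show ?case using entry[of i "Suc i"] Suc.IH[of "Suc i"] by (auto simp: xS split: if_splits)
  qed
  have Jx: "J *\<^sub>v vec n (x k l) = k \<cdot>\<^sub>v vec n (x k l) + vec n (x k (Suc l))" for k l
  proof (rule eq_vecI)
    fix i assume "i < dim_vec (k \<cdot>\<^sub>v vec n (x k l) + vec n (x k (Suc l)))"
    then have i: "i < n" by simp
    have "(J *\<^sub>v vec n (x k l)) $ i = (\<Sum>j = 0..<n. J $$ (i, j) * x k l j)"
      using i J by (auto simp: scalar_prod_def)
    also have "\<dots> = (\<Sum>j = 0..<n. (if j = i then J $$ (i, i) * x k l i else 0) +
        (if j = Suc i then J $$ (i, Suc i) * x k l (Suc i) else 0))"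
    proof (rule sum.cong)
      fix j assume "j \<in> {0..<n}"
      then have "j = i \<or> j = Suc i \<or> J $$ (i, j) = 0" using entry[OF i, of j] by force
      then show "J $$ (i, j) * x k l j = (if j = i then J $$ (i, i) * x k l i else 0) +
          (if j = Suc i then J $$ (i, Suc i) * x k l (Suc i) else 0)" by auto
    qed simp
    also have "\<dots> = J $$ (i, i) * x k l i + x k (Suc l) i"
      using i by (simp add: sum.distrib xS)
    also have "J $$ (i, i) * x k l i = k * x k l i" using supp[of k l i] by auto
    finally show "(J *\<^sub>v vec n (x k l)) $ i = (k \<cdot>\<^sub>v vec n (x k l) + vec n (x k (Suc l))) $ i"
      using i by simp
  qed (use J in auto)
  define w where "w k l = P *\<^sub>v vec n (x k l)" for k l
  show thesis
  proof (rule that[of "(\<lambda>i. J $$ (i, i)) ` {0..<n}" w])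
    show "w k l \<in> carrier_vec n" for k l unfolding w_def using P by simp
    show "A *\<^sub>v w k l = k \<cdot>\<^sub>v w k l + w k (Suc l)" for k l
    proof -
      have "A *\<^sub>v w k l = (P * J) *\<^sub>v vec n (x k l)"
        unfolding w_def AP[symmetric] using A P by (simp add: assoc_mult_mat_vec[of _ n n _ n])
      also have "\<dots> = P *\<^sub>v (J *\<^sub>v vec n (x k l))"
        using J P by (simp add: assoc_mult_mat_vec[of _ n n _ n])
      finally show ?thesis unfolding Jx w_def using P
        by (simp add: mult_add_distrib_mat_vec[of _ n n] mult_mat_vec[of _ n n])
    qed
    show "w k l = 0\<^sub>v n" if "n \<le> l" for k l
    proof -
      have "vec n (x k l) = 0\<^sub>v n" using supp[of k l] that by (intro eq_vecI) force+
      then show ?thesis unfolding w_def using P by auto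
    qed
    fix i assume i: "i < n"
    \<comment> \<open>For each index \<open>j\<close> exactly one \<open>k\<close> contributes, the
      diagonal entry of \<open>J\<close> at \<open>j\<close>.\<close>
    have yj: "(\<Sum>k\<in>(\<lambda>i. J $$ (i, i)) ` {0..<n}. x k 0 j) = y $ j" if "j < n" for j
      using that by (simp add: x0)
    have "z $ i = (\<Sum>j = 0..<n. P $$ (i, j) * y $ j)"
      unfolding zPy using i P y by (auto simp: scalar_prod_def)
    also have "\<dots> = (\<Sum>j = 0..<n. P $$ (i, j) * (\<Sum>k\<in>(\<lambda>i. J $$ (i, i)) ` {0..<n}. x k 0 j))"
      by (intro sum.cong) (auto simp: yj)
    also have "\<dots> = (\<Sum>k\<in>(\<lambda>i. J $$ (i, i)) ` {0..<n}. \<Sum>j = 0..<n. P $$ (i, j) * x k 0 j)"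
      unfolding sum_distrib_left by (rule sum.swap)
    also have "\<dots> = (\<Sum>k\<in>(\<lambda>i. J $$ (i, i)) ` {0..<n}. w k 0 $ i)"
      unfolding w_def using i P by (auto simp: scalar_prod_def)
    finally show "z $ i = (\<Sum>k\<in>(\<lambda>i. J $$ (i, i)) ` {0..<n}. w k 0 $ i)" .
  qed simp
qed

text \<open>This is the binomial expansion of the powers of \<open>k + (A - k)\<close>, where
  \<open>A - k\<close> acts on the chain as a shift. The starting index \<open>h\<close> is free
  because the induction step passes from \<open>h\<close> to \<open>Suc h\<close>.\<close>

lemma mat_power_generalized_eigenvector:
  fixes A :: "complex mat"
  assumes A: "A \<in> carrier_mat n n" and w: "\<And>l. w l \<in> carrier_vec n"
    and chain: "\<And>l. A *\<^sub>v w l = k \<cdot>\<^sub>v w l + w (Suc l)" and i: "i < n"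
  shows "(A ^\<^sub>m m *\<^sub>v w h) $ i = (\<Sum>l\<le>m. of_nat (m choose l) * k ^ (m - l) * w (h + l) $ i)"
proof (induction m arbitrary: h)
  case 0
  then show ?case using A w by simp
next
  case (Suc m)
  have "A ^\<^sub>m Suc m *\<^sub>v w h = A ^\<^sub>m m *\<^sub>v (k \<cdot>\<^sub>v w h + w (Suc h))"
    using A w by (simp add: assoc_mult_mat_vec[of _ n n _ n] chain)
  also have "\<dots> = k \<cdot>\<^sub>v (A ^\<^sub>m m *\<^sub>v w h) + A ^\<^sub>m m *\<^sub>v w (Suc h)"
    using A w by (simp add: mult_add_distrib_mat_vec[of _ n n] mult_mat_vec[of _ n n])
  finally have "(A ^\<^sub>m Suc m *\<^sub>v w h) $ i =
      k * (\<Sum>l\<le>m. of_nat (m choose l) * k ^ (m - l) * w (h + l) $ i)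
      + (\<Sum>l\<le>m. of_nat (m choose l) * k ^ (m - l) * w (Suc h + l) $ i)"
    unfolding Suc.IH[symmetric] using A w i by (simp del: index_mult_mat_vec)
  \<comment> \<open>The added term \<open>l = Suc m\<close> is zero because
    \<open>m choose Suc m\<close> is. After shifting the index, Pascal's rule merges the two
    sums.\<close>
  also have "k * (\<Sum>l\<le>m. of_nat (m choose l) * k ^ (m - l) * w (h + l) $ i) =
      (\<Sum>l\<le>Suc m. of_nat (m choose l) * k ^ (Suc m - l) * w (h + l) $ i)"
    by (simp add: sum_distrib_left Suc_diff_le mult_ac)
  also have "\<dots> = k ^ Suc m * w h $ i +
      (\<Sum>l\<le>m. of_nat (m choose Suc l) * k ^ (m - l) * w (Suc h + l) $ i)"
    by (subst sum.atMost_Suc_shift) simp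
  finally show ?case
    by (subst sum.atMost_Suc_shift) (simp add: sum.distrib ring_distribs)
qed

section \<open>Averaging a diagonal Hermitian form along the orbit\<close>

text \<open>Expanding the square and averaging over \<open>m\<close> removes the cross terms between
  distinct phases and leaves the diagonal ones. Distinctness is asked only where \<open>c\<close> is
  non-zero, since terms of slower growth, which have \<open>c j = 0\<close>, may share a phase with
  others.\<close>

lemma weighted_norm_average_nonneg:
  fixes a v :: "'i \<Rightarrow> nat \<Rightarrow> complex" and e :: "nat \<Rightarrow> real"
  assumes I: "finite I"
    and a: "\<And>j. j \<in> I \<Longrightarrow> (\<lambda>m. a j m - c j * w j ^ m) \<longlonglongrightarrow> 0"
    and w: "\<And>j. j \<in> I \<Longrightarrow> norm (w j) = 1"
    and inj: "\<And>i j. i \<in> I \<Longrightarrow> j \<in> I \<Longrightarrow> c i \<noteq> 0 \<Longrightarrow> c j \<noteq> 0 \<Longrightarrow> w i = w j \<Longrightarrow> i = j"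
    and nonneg: "\<forall>\<^sub>F m in sequentially. 0 \<le> (\<Sum>x<N. e x * (norm (\<Sum>j\<in>I. a j m * v j x))\<^sup>2)"
  shows "0 \<le> (\<Sum>j\<in>I. (norm (c j))\<^sup>2 * (\<Sum>x<N. e x * (norm (v j x))\<^sup>2))" (is "0 \<le> ?L")
proof -
  define F where "F m = (\<Sum>x<N. e x * (norm (\<Sum>j\<in>I. a j m * v j x))\<^sup>2)" for m
  have F: "complex_of_real (F m) = (\<Sum>x<N. \<Sum>i\<in>I. \<Sum>j\<in>I.
      e x * (v i x * cnj (v j x)) * (a i m * cnj (a j m)))" for m
    unfolding F_def
    by (simp add: complex_norm_square sum_product sum_distrib_left mult_ac del: of_real_power)
      (rule sum.cong[OF refl], rule sum.swap)
  have "(\<lambda>n. \<Sum>x<N. \<Sum>i\<in>I. \<Sum>j\<in>I.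
      e x * (v i x * cnj (v j x)) * cesaro_mean (\<lambda>m. a i m * cnj (a j m)) n)
      \<longlonglongrightarrow> (\<Sum>x<N. \<Sum>i\<in>I. \<Sum>j\<in>I.
      e x * (v i x * cnj (v j x)) * (if w i = w j then c i * cnj (c j) else 0))"
    by (intro tendsto_sum tendsto_mult_left cesaro_mean_product a w)
  moreover have "cesaro_mean (\<lambda>m. complex_of_real (F m)) = (\<lambda>n. \<Sum>x<N. \<Sum>i\<in>I. \<Sum>j\<in>I.
      e x * (v i x * cnj (v j x)) * cesaro_mean (\<lambda>m. a i m * cnj (a j m)) n)"
    unfolding F cesaro_mean_sum cesaro_mean_cmult ..
  moreover have "(\<Sum>x<N. \<Sum>i\<in>I. \<Sum>j\<in>I.
      e x * (v i x * cnj (v j x)) * (if w i = w j then c i * cnj (c j) else 0)) = of_real ?L"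
  proof -
    have "(\<Sum>x<N. \<Sum>i\<in>I. \<Sum>j\<in>I.
        e x * (v i x * cnj (v j x)) * (if w i = w j then c i * cnj (c j) else 0)) =
      (\<Sum>x<N. \<Sum>i\<in>I. \<Sum>j\<in>I. if i = j
        then e x * (v i x * cnj (v i x)) * (c i * cnj (c i)) else 0)"
    proof (intro sum.cong refl)
      fix x i j assume "i \<in> I" "j \<in> I"
      then show "e x * (v i x * cnj (v j x)) * (if w i = w j then c i * cnj (c j) else 0) =
          (if i = j then e x * (v i x * cnj (v i x)) * (c i * cnj (c i)) else 0)"
        using inj[of i j] by auto
    qed
    also have "\<dots> = (\<Sum>x<N. \<Sum>i\<in>I. of_real (e x * (norm (v i x))\<^sup>2 * (norm (c i))\<^sup>2))"
      using I by (simp add: complex_norm_square del: of_real_power)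
    also have "\<dots> = (\<Sum>i\<in>I. \<Sum>x<N. of_real (e x * (norm (v i x))\<^sup>2 * (norm (c i))\<^sup>2))"
      by (rule sum.swap)
    also have "\<dots> = of_real ?L" by (simp add: sum_distrib_left mult_ac)
    finally show ?thesis .
  qed
  ultimately have lim: "cesaro_mean (\<lambda>m. complex_of_real (F m)) \<longlonglongrightarrow> of_real ?L" by simp
  obtain M where M: "\<And>m. m \<ge> M \<Longrightarrow> 0 \<le> F m"
    using nonneg unfolding F_def[symmetric] eventually_sequentially by blast
  show ?thesis
  proof (rule LIMSEQ_le)
    \<comment> \<open>The finitely many values before \<open>M\<close> may be negative, but their
      total divided by \<open>n\<close> bounds the mean from below and tends to 0.\<close>
    show "(\<lambda>n. (\<Sum>m<M. F m) / of_nat n) \<longlonglongrightarrow> 0" by (rule lim_const_over_n)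
    show "(\<lambda>n. Re (cesaro_mean (\<lambda>m. complex_of_real (F m)) n)) \<longlonglongrightarrow> ?L"
      using tendsto_Re[OF lim] by simp
    show "\<exists>n0. \<forall>n\<ge>n0. (\<Sum>m<M. F m) / of_nat n \<le> Re (cesaro_mean (\<lambda>m. complex_of_real (F m)) n)"
    proof (intro exI[of _ M] allI impI)
      fix n assume n: "n \<ge> M"
      have "(\<Sum>m<M. F m) \<le> (\<Sum>m<n. F m)" using n M by (intro sum_mono2) auto
      moreover have "cesaro_mean (\<lambda>m. complex_of_real (F m)) n = of_real ((\<Sum>m<n. F m) / of_nat n)"
        unfolding cesaro_mean_def by simp
      ultimately show "(\<Sum>m<M. F m) / of_nat n \<le> Re (cesaro_mean (\<lambda>m. complex_of_real (F m)) n)"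
        by (simp only: Re_complex_of_real divide_right_mono of_nat_0_le_iff)
    qed
  qed
qed

section \<open>Comparison of growth rates\<close>

text \<open>Counting nested subsets in two ways turns the ratio into a constant over
  \<open>(m - l) choose (k - l)\<close>, which grows at least like a positive power of
  \<open>m - l\<close>.\<close>

lemma binomial_ratio_tendsto_0:
  assumes "l < k"
  shows "(\<lambda>m. real (m choose l) / real (m choose k)) \<longlonglongrightarrow> 0"
proof (rule tendsto_sandwich[OF _ _ tendsto_const])
  show "\<forall>\<^sub>F m in sequentially. 0 \<le> real (m choose l) / real (m choose k)" by simp
  show "\<forall>\<^sub>F m in sequentially. real (m choose l) / real (m choose k)
      \<le> real (k choose l) * real (k - l) ^ (k - l) / (real m - real l) ^ (k - l)"
    using eventually_gt_at_top[of k]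
  proof eventually_elim
    case (elim m)
    have "(m choose l) * ((m - l) choose (k - l)) = (m choose k) * (k choose l)"
      using assms elim choose_mult[of l k m] by simp
    then have "real (m choose l) * real ((m - l) choose (k - l)) = real (m choose k) * real (k choose l)"
      by (metis of_nat_mult)
    then have "real (m choose l) / real (m choose k) = real (k choose l) / real ((m - l) choose (k - l))"
      using elim assms by (simp add: field_simps)
    also have "\<dots> \<le> real (k choose l) / (real (m - l) / real (k - l)) ^ (k - l)"
      using elim assms by (intro divide_left_mono binomial_ge_n_over_k_pow_k mult_pos_pos zero_less_power) auto
    also have "\<dots> = real (k choose l) * real (k - l) ^ (k - l) / (real m - real l) ^ (k - l)"
      using elim assms by (simp add: power_divide of_nat_diff)
    finally show ?case .
  qed
  have "filterlim (\<lambda>m. real m - real l) at_top sequentially" by real_asymp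
  then have "filterlim (\<lambda>m. (real m - real l) ^ (k - l)) at_top sequentially"
    using assms by (intro filterlim_pow_at_top) auto
  then show "(\<lambda>m. real (k choose l) * real (k - l) ^ (k - l) / (real m - real l) ^ (k - l)) \<longlonglongrightarrow> 0"
    by (intro tendsto_divide_0[OF tendsto_const] filterlim_at_top_imp_at_infinity)
qed

lemma power_mult_geometric_tendsto_0:
  fixes x :: real
  assumes "0 < x" "x < 1"
  shows "(\<lambda>m. real m ^ l * x ^ m) \<longlonglongrightarrow> 0"
  using assms by real_asymp

text \<open>If the modulus of \<open>b\<close> is below \<open>r\<close>, geometric decay beats the
  polynomial bound \<open>m ^ l\<close> on the binomials; if it equals \<open>r\<close>, the ratio
  of the binomials alone tends to 0.\<close>

lemma dominated_coefficient_tendsto_0: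
  fixes b :: complex
  assumes b: "b \<noteq> 0" and dom: "norm b < r \<or> norm b = r \<and> l < k"
  shows "(\<lambda>m. of_nat (m choose l) * b ^ (m - l) / (of_nat (m choose k) * of_real r ^ m)) \<longlonglongrightarrow> 0"
    (is "?f \<longlonglongrightarrow> 0")
proof -
  have r: "r > 0" using b dom by (metis order_less_trans zero_less_norm_iff)
  define x where "x = norm b / r"
  have x: "0 < x" using b r by (simp add: x_def)
  have nf: "norm (?f m) = (real (m choose l) / real (m choose k)) * x ^ m / norm b ^ l"
    if "m \<ge> l" for m
  proof -
    have "norm b ^ (m - l) = norm b ^ m / norm b ^ l" using that b by (subst power_diff) auto
    moreover have "s * (u / v) / (d * t) = s / d * (u / t) / v" for s t u v d :: real
      by (simp add: mult_ac)
    moreover have "norm (of_real r :: complex) = r" using r by simp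
    ultimately show ?thesis
      by (simp only: norm_mult norm_divide norm_power norm_of_nat x_def power_divide)
  qed
  have "(\<lambda>m. (real (m choose l) / real (m choose k)) * x ^ m) \<longlonglongrightarrow> 0"
  proof (cases "norm b = r")
    case True
    then show ?thesis using dom r binomial_ratio_tendsto_0 by (simp add: x_def)
  next
    case False
    then have "x < 1" using dom r by (simp add: x_def)
    show ?thesis
    proof (rule tendsto_sandwich[OF _ _ tendsto_const])
      show "\<forall>\<^sub>F m in sequentially. 0 \<le> (real (m choose l) / real (m choose k)) * x ^ m"
        using x by simp
      show "\<forall>\<^sub>F m in sequentially. (real (m choose l) / real (m choose k)) * x ^ m \<le> real m ^ l * x ^ m"
        using eventually_ge_at_top[of "max k l"]
      proof eventually_elim
        case (elim m)
        have "(m choose l) \<le> m ^ l" using elim by (intro binomial_le_pow) simp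
        moreover have "(m choose k) \<ge> 1" using elim by (simp add: Suc_le_eq)
        ultimately have "real (m choose l) / real (m choose k) \<le> real (m ^ l) / 1"
          by (intro frac_le of_nat_mono) auto
        then show ?case using x by (intro mult_right_mono) auto
      qed
      show "(\<lambda>m. real m ^ l * x ^ m) \<longlonglongrightarrow> 0"
        using power_mult_geometric_tendsto_0 x \<open>x < 1\<close> .
    qed
  qed
  from tendsto_divide[OF this tendsto_const, of "norm b ^ l"]
  have "(\<lambda>m. (real (m choose l) / real (m choose k)) * x ^ m / norm b ^ l) \<longlonglongrightarrow> 0"
    using b by simp
  moreover have "\<forall>\<^sub>F m in sequentially.
      (real (m choose l) / real (m choose k)) * x ^ m / norm b ^ l = norm (?f m)"
    using eventually_ge_at_top[of l] by eventually_elim (simp only: nf)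
  ultimately show ?thesis by (intro tendsto_norm_zero_cancel[of ?f]) (rule Lim_transform_eventually)
qed

section \<open>From a positive orbit to the fixed point\<close>

lemma H_form_sgn_sum:
  assumes "z \<in> carrier_vec (p + q)"
  shows "H_form p q z =
    of_real (\<Sum>i<p + q. (if i < p then 1 else - 1) * (norm (z $ i))\<^sup>2)"
proof -
  have "(\<Sum>i<p + q. (if i < p then 1 else - 1) * (norm (z $ i))\<^sup>2) =
    (\<Sum>i\<in>{..<p} \<union> {p..<p + q}. (if i < p then 1 else - 1) * (norm (z $ i))\<^sup>2)"
    by (rule sum.cong) auto
  also have "\<dots> = (\<Sum>i<p. (norm (z $ i))\<^sup>2) - (\<Sum>i\<in>{p..<p + q}. (norm (z $ i))\<^sup>2)"
  proof (subst sum.union_disjoint)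
    have "(\<Sum>i<p. (if i < p then 1 else - 1) * (norm (z $ i))\<^sup>2) = (\<Sum>i<p. (norm (z $ i))\<^sup>2)"
      by (rule sum.cong) auto
    moreover have "(\<Sum>i\<in>{p..<p + q}. (if i < p then 1 else - 1) * (norm (z $ i))\<^sup>2) =
        - (\<Sum>i\<in>{p..<p + q}. (norm (z $ i))\<^sup>2)"
      unfolding sum_negf[symmetric] by (rule sum.cong) auto
    ultimately show "(\<Sum>i<p. (if i < p then 1 else - 1) * (norm (z $ i))\<^sup>2) +
        (\<Sum>i\<in>{p..<p + q}. (if i < p then 1 else - 1) * (norm (z $ i))\<^sup>2) =
        (\<Sum>i<p. (norm (z $ i))\<^sup>2) - (\<Sum>i\<in>{p..<p + q}. (norm (z $ i))\<^sup>2)"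
      by simp
  qed auto
  finally show ?thesis unfolding H_form_sum[OF assms] by (rule arg_cong[OF sym])
qed

text \<open>An orbit that never reaches zero must have a component at a non-zero eigenvalue, which
  makes the dominant rate \<open>r\<close> positive.\<close>

lemma eigenvector_of_nonneg_orbit:
  fixes A :: "complex mat" and e :: "nat \<Rightarrow> real"
  assumes A: "A \<in> carrier_mat n n" and z: "z \<in> carrier_vec n"
    and nz: "\<And>m. A ^\<^sub>m m *\<^sub>v z \<noteq> 0\<^sub>v n"
    and nonneg: "\<And>m. 0 \<le> (\<Sum>x<n. e x * (norm ((A ^\<^sub>m m *\<^sub>v z) $ x))\<^sup>2)"
  shows "\<exists>v b. eigenvector A v b \<and> b \<noteq> 0 \<and> 0 \<le> (\<Sum>x<n. e x * (norm (v $ x))\<^sup>2)"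
proof -
  obtain S w where S: "finite S" and w: "\<And>b l. w b l \<in> carrier_vec n"
    and chain: "\<And>b l. A *\<^sub>v w b l = b \<cdot>\<^sub>v w b l + w b (Suc l)"
    and w0: "\<And>b l. n \<le> l \<Longrightarrow> w b l = 0\<^sub>v n"
    and zw: "\<And>i. i < n \<Longrightarrow> z $ i = (\<Sum>b\<in>S. w b 0 $ i)"
    by (rule generalized_eigenvector_decomposition[OF A z], rule that)
  \<comment> \<open>Pairs of an eigenvalue and a depth in its chain. Zero vectors are left out so
    that the maxima below are attained by terms really present.\<close>
  define I where "I = {j \<in> (S - {0}) \<times> {..<n}. w (fst j) (snd j) \<noteq> 0\<^sub>v n}"
  have I: "finite I" unfolding I_def using S by simp
  have orbit: "(A ^\<^sub>m m *\<^sub>v z) $ i =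
      (\<Sum>j\<in>I. of_nat (m choose snd j) * fst j ^ (m - snd j) * w (fst j) (snd j) $ i)"
    if m: "n \<le> m" and i: "i < n" for m i
  proof -
    let ?t = "\<lambda>b l. of_nat (m choose l) * b ^ (m - l) * w b l $ i"
    have "(A ^\<^sub>m m *\<^sub>v z) $ i = (\<Sum>j = 0..<n. (A ^\<^sub>m m) $$ (i, j) * z $ j)"
      using A z i pow_carrier_mat[OF A, of m] by (auto simp: scalar_prod_def)
    also have "\<dots> = (\<Sum>j = 0..<n. \<Sum>b\<in>S. (A ^\<^sub>m m) $$ (i, j) * w b 0 $ j)"
      by (intro sum.cong) (auto simp: zw sum_distrib_left)
    also have "\<dots> = (\<Sum>b\<in>S. \<Sum>j = 0..<n. (A ^\<^sub>m m) $$ (i, j) * w b 0 $ j)"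
      by (rule sum.swap)
    also have "\<dots> = (\<Sum>b\<in>S. (A ^\<^sub>m m *\<^sub>v w b 0) $ i)"
    proof (rule sum.cong)
      fix b
      show "(\<Sum>j = 0..<n. (A ^\<^sub>m m) $$ (i, j) * w b 0 $ j) = (A ^\<^sub>m m *\<^sub>v w b 0) $ i"
        using carrier_vecD[OF w[of b 0]] carrier_matD[OF pow_carrier_mat[OF A, of m]] i
        by (simp add: scalar_prod_def)
    qed simp
    also have "\<dots> = (\<Sum>b\<in>S. \<Sum>l\<le>m. ?t b l)"
      using mat_power_generalized_eigenvector[where w = "w b" and k = b and h = 0 for b, OF A w chain i]
      by (simp del: index_mult_mat_vec)
    also have "\<dots> = (\<Sum>b\<in>S. \<Sum>l<n. ?t b l)"
      using m i by (intro sum.cong refl sum.mono_neutral_right) (auto simp: w0)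
    \<comment> \<open>Since \<open>l < n\<close> and \<open>n \<le> m\<close>, the exponent
      \<open>m - l\<close> is positive, so the eigenvalue 0 contributes nothing.\<close>
    also have "\<dots> = (\<Sum>b\<in>S - {0}. \<Sum>l<n. ?t b l)"
      using S m by (intro sum.mono_neutral_right) (auto intro!: sum.neutral)
    also have "\<dots> = (\<Sum>j\<in>(S - {0}) \<times> {..<n}. ?t (fst j) (snd j))"
      by (simp add: sum.cartesian_product case_prod_unfold)
    also have "\<dots> = (\<Sum>j\<in>I. ?t (fst j) (snd j))"
      using S i unfolding I_def by (intro sum.mono_neutral_right) auto
    finally show ?thesis .
  qed
  have "I \<noteq> {}"
  proof
    assume "I = {}"
    then have "A ^\<^sub>m n *\<^sub>v z = 0\<^sub>v n"
      using orbit[of n] pow_carrier_mat[OF A, of n] by (intro eq_vecI) auto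
    then show False using nz by blast
  qed
  define r where "r = Max ((\<lambda>j. norm (fst j)) ` I)"
  define T where "T = {j \<in> I. norm (fst j) = r}"
  define k where "k = Max (snd ` T)"
  have r: "norm (fst j) \<le> r" if "j \<in> I" for j unfolding r_def using I that by simp
  have "r \<in> (\<lambda>j. norm (fst j)) ` I" unfolding r_def using I \<open>I \<noteq> {}\<close> by (intro Max_in) auto
  then have T: "T \<noteq> {}" "finite T" unfolding T_def using I by auto
  have k: "snd j \<le> k" if "j \<in> T" for j unfolding k_def using T that by simp
  have "k \<in> snd ` T" unfolding k_def using T by (intro Max_in) auto
  then obtain t where t: "t \<in> T" "snd t = k" by blast
  have nz_fst: "fst j \<noteq> 0" if "j \<in> I" for j using that unfolding I_def by auto
  have rpos: "r > 0" using t(1) nz_fst[of t] unfolding T_def by auto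
  define a where "a j m = of_nat (m choose snd j) * fst j ^ (m - snd j) /
    (of_nat (m choose k) * of_real r ^ m)" for j :: "complex \<times> nat" and m
  \<comment> \<open>For a dominant pair with eigenvalue \<open>b\<close> the binomials cancel once
    \<open>k \<le> m\<close>, and \<open>b ^ (m - k) / r ^ m\<close> is \<open>1 / b ^ k\<close>
    times the \<open>m\<close>-th power of the phase of \<open>b\<close>.\<close>
  define c where "c j = (if j \<in> T \<and> snd j = k then 1 / fst j ^ k else 0)" for j
  have "0 \<le> (\<Sum>j\<in>I. (norm (c j))\<^sup>2 * (\<Sum>x<n. e x * (norm (w (fst j) (snd j) $ x))\<^sup>2))"
  proof (rule weighted_norm_average_nonneg[where w = "\<lambda>j. fst j / norm (fst j)" and a = a
        and v = "\<lambda>j x. w (fst j) (snd j) $ x" and c = c and I = I and N = n and e = e])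
    fix j assume j: "j \<in> I"
    show "norm (fst j / norm (fst j)) = 1" using nz_fst[OF j] by (simp add: norm_divide)
    show "(\<lambda>m. a j m - c j * (fst j / norm (fst j)) ^ m) \<longlonglongrightarrow> 0"
    proof (cases "j \<in> T \<and> snd j = k")
      case True
      have "\<forall>\<^sub>F m in sequentially. a j m - c j * (fst j / norm (fst j)) ^ m = 0"
        using eventually_ge_at_top[of k]
      proof eventually_elim
        case (elim m)
        then show ?case using True nz_fst[OF j] rpos
          by (simp add: a_def c_def T_def power_divide power_diff)
      qed
      then show ?thesis by (rule tendsto_eventually)
    next
      case False
      then have "norm (fst j) < r \<or> norm (fst j) = r \<and> snd j < k"
        using r[OF j] k[of j] j unfolding T_def by force
      then have "a j \<longlonglongrightarrow> 0"
        unfolding a_def by (rule dominated_coefficient_tendsto_0[OF nz_fst[OF j]])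
      moreover have "c j = 0" unfolding c_def using False by (rule if_not_P)
      ultimately show ?thesis by simp
    qed
  next
    \<comment> \<open>Non-zero \<open>c\<close> forces modulus \<open>r\<close> and depth
      \<open>k\<close>, so equal phases give equal eigenvalues and hence equal pairs.\<close>
    fix i j
    assume "c i \<noteq> 0" "c j \<noteq> 0" "fst i / norm (fst i) = fst j / norm (fst j)"
    then show "i = j" using rpos by (auto simp: c_def T_def prod_eq_iff split: if_splits)
  next
    show "\<forall>\<^sub>F m in sequentially.
        0 \<le> (\<Sum>x<n. e x * (norm (\<Sum>j\<in>I. a j m * w (fst j) (snd j) $ x))\<^sup>2)"
      using eventually_ge_at_top[of n]
    proof eventually_elim
      case (elim m)
      let ?d = "of_nat (m choose k) * of_real r ^ m :: complex"
      have "(\<Sum>j\<in>I. a j m * w (fst j) (snd j) $ x) = (A ^\<^sub>m m *\<^sub>v z) $ x / ?d" if "x < n" for x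
        unfolding orbit[OF elim that] a_def by (simp add: sum_divide_distrib)
      then have "(\<Sum>x<n. e x * (norm (\<Sum>j\<in>I. a j m * w (fst j) (snd j) $ x))\<^sup>2) =
          (\<Sum>x<n. e x * (norm ((A ^\<^sub>m m *\<^sub>v z) $ x))\<^sup>2) / (norm ?d)\<^sup>2"
        unfolding sum_divide_distrib
        by (intro sum.cong) (simp_all add: norm_divide power_divide del: index_mult_mat_vec)
      then show ?case using nonneg[of m] by simp
    qed
  qed (rule I)
  then have "\<exists>j\<in>I. c j \<noteq> 0 \<and> 0 \<le> (\<Sum>x<n. e x * (norm (w (fst j) (snd j) $ x))\<^sup>2)"
  proof (rule contrapos_pp)
    assume neg: "\<not> (\<exists>j\<in>I. c j \<noteq> 0 \<and> 0 \<le> (\<Sum>x<n. e x * (norm (w (fst j) (snd j) $ x))\<^sup>2))"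
    have tI: "t \<in> I" using t unfolding T_def by simp
    have ct: "c t \<noteq> 0" unfolding c_def using t nz_fst[OF tI] by simp
    \<comment> \<open>If every dominant vector had a negative value, no term would be positive and
      the one at \<open>t\<close> would be negative.\<close>
    have "(\<Sum>j\<in>I. (norm (c j))\<^sup>2 * (\<Sum>x<n. e x * (norm (w (fst j) (snd j) $ x))\<^sup>2)) < (\<Sum>j\<in>I. 0)"
    proof (rule sum_strict_mono_ex1[OF I])
      show "\<forall>j\<in>I. (norm (c j))\<^sup>2 * (\<Sum>x<n. e x * (norm (w (fst j) (snd j) $ x))\<^sup>2) \<le> 0"
      proof
        fix j assume "j \<in> I"
        then have "c j = 0 \<or> (\<Sum>x<n. e x * (norm (w (fst j) (snd j) $ x))\<^sup>2) < 0"
          using neg by force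
        then show "(norm (c j))\<^sup>2 * (\<Sum>x<n. e x * (norm (w (fst j) (snd j) $ x))\<^sup>2) \<le> 0"
          by (auto intro: mult_nonneg_nonpos)
      qed
      have "(\<Sum>x<n. e x * (norm (w (fst t) (snd t) $ x))\<^sup>2) < 0" using neg tI ct by force
      then show "\<exists>j\<in>I. (norm (c j))\<^sup>2 * (\<Sum>x<n. e x * (norm (w (fst j) (snd j) $ x))\<^sup>2) < 0"
        using tI ct by (intro bexI[of _ t] mult_pos_neg) auto
    qed
    then show "\<not> 0 \<le> (\<Sum>j\<in>I. (norm (c j))\<^sup>2 * (\<Sum>x<n. e x * (norm (w (fst j) (snd j) $ x))\<^sup>2))"
      by simp
  qed
  then obtain j where j: "j \<in> I" "c j \<noteq> 0"
    and pos: "0 \<le> (\<Sum>x<n. e x * (norm (w (fst j) (snd j) $ x))\<^sup>2)" by blast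
  have jT: "j \<in> T" "snd j = k" using j(2) unfolding c_def by (auto split: if_splits)
  \<comment> \<open>Otherwise depth \<open>Suc k\<close> would also occur at modulus
    \<open>r\<close>, against the choice of \<open>k\<close>. So the chain ends here and its last
    vector is an eigenvector.\<close>
  have "w (fst j) (Suc k) = 0\<^sub>v n"
  proof (rule ccontr)
    assume "w (fst j) (Suc k) \<noteq> 0\<^sub>v n"
    then have "(fst j, Suc k) \<in> T"
      using jT(1) w0[of "Suc k" "fst j"] unfolding T_def I_def by force
    then show False using k by force
  qed
  then have "A *\<^sub>v w (fst j) k = fst j \<cdot>\<^sub>v w (fst j) k"
    using chain[of "fst j" k] w[of "fst j" k] by simp
  then have "eigenvector A (w (fst j) k) (fst j)"
    using j(1) jT(2) w A unfolding eigenvector_def I_def by auto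
  then show ?thesis using nz_fst[OF j(1)] pos jT(2) by blast
qed

theorem theorem4p1:
  fixes p q :: nat
    and f :: "complex vec set \<Rightarrow> complex vec set"
    and A :: "complex mat"
  assumes "p \<ge> 1" and "q \<ge> 1"
    and "linear_self_map p q f"
    and "matrix_representation p q A f"
  shows "\<exists>P \<in> fixed_points A. P \<in> closed_gen_ball p q"
proof -
  let ?n = "p + q" and ?e = "\<lambda>i. if i < p then 1 else - 1 :: real"
  have A: "A \<in> carrier_mat ?n ?n"
    and rep: "\<And>z. z \<in> carrier_vec ?n \<Longrightarrow> 0 < H_form p q z \<Longrightarrow>
      A *\<^sub>v z \<noteq> 0\<^sub>v ?n \<and> f (proj_pt z) = proj_pt (A *\<^sub>v z)"
    using assms(4) unfolding matrix_representation_def by auto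
  have ball: "f P \<in> gen_ball p q" if "P \<in> gen_ball p q" for P
    using assms(3) that unfolding linear_self_map_def by blast
  have H_zero: "\<not> 0 < H_form p q (0\<^sub>v ?n)" by (simp add: H_form_sgn_sum)
  \<comment> \<open>The sign of the form depends only on the projective point, so a self map of the
    ball keeps representing vectors positive.\<close>
  have step: "0 < H_form p q (A *\<^sub>v z)" if z: "z \<in> carrier_vec ?n" "0 < H_form p q z" for z
  proof -
    have "z \<noteq> 0\<^sub>v ?n" using z(2) H_zero by auto
    then have "proj_pt (A *\<^sub>v z) \<in> gen_ball p q"
      using ball[of "proj_pt z"] proj_pt_in_gen_ball[OF z(1)] rep[OF z] z(2) by simp
    then show ?thesis using proj_pt_in_gen_ball[of "A *\<^sub>v z"] A z(1) rep[OF z] by simp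
  qed
  \<comment> \<open>The first basis vector has value 1 because \<open>p \<ge> 1\<close>.\<close>
  define z :: "complex vec" where "z = unit_vec ?n 0"
  have z: "z \<in> carrier_vec ?n" unfolding z_def by simp
  have "(\<Sum>i<?n. ?e i * (norm (z $ i))\<^sup>2) = (\<Sum>i<?n. if i = 0 then 1 else 0)"
    using assms(1) unfolding z_def by (intro sum.cong) auto
  then have "0 < H_form p q z" using assms(1) unfolding H_form_sgn_sum[OF z] by (simp add: less_complex_def)
  have orbit: "0 < H_form p q (A ^\<^sub>m m *\<^sub>v y)"
    if "y \<in> carrier_vec ?n" "0 < H_form p q y" for m y
    using that
  proof (induction m arbitrary: y)
    case 0
    then show ?case using A by simp
  next
    case (Suc m)
    \<comment> \<open>Matrix powers grow on the right, so the induction applies to the new starting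
      vector \<open>A *\<^sub>v y\<close>; hence \<open>y\<close> is arbitrary.\<close>
    have "A ^\<^sub>m Suc m *\<^sub>v y = A ^\<^sub>m m *\<^sub>v (A *\<^sub>v y)"
      using A Suc.prems(1) by (simp add: assoc_mult_mat_vec[of _ ?n ?n _ ?n])
    then show ?case using Suc.IH[of "A *\<^sub>v y"] step[OF Suc.prems] A Suc.prems(1) by simp
  qed
  note orbit_z = orbit[OF z \<open>0 < H_form p q z\<close>]
  have car: "A ^\<^sub>m m *\<^sub>v z \<in> carrier_vec ?n" for m
    using mult_mat_vec_carrier[OF pow_carrier_mat[OF A] z] .
  obtain v b where v: "eigenvector A v b" "b \<noteq> 0"
    and pos: "0 \<le> (\<Sum>i<?n. ?e i * (norm (v $ i))\<^sup>2)"
  proof -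
    have "\<exists>v b. eigenvector A v b \<and> b \<noteq> 0 \<and> 0 \<le> (\<Sum>i<?n. ?e i * (norm (v $ i))\<^sup>2)"
    proof (rule eigenvector_of_nonneg_orbit[OF A z])
      fix m
      show "A ^\<^sub>m m *\<^sub>v z \<noteq> 0\<^sub>v ?n" using orbit_z[of m] H_zero by metis
      show "0 \<le> (\<Sum>i<?n. ?e i * (norm ((A ^\<^sub>m m *\<^sub>v z) $ i))\<^sup>2)"
        using orbit_z[of m] unfolding H_form_sgn_sum[OF car] less_complex_def by simp
    qed
    then show thesis using that by blast
  qed
  have vc: "v \<in> carrier_vec ?n" "v \<noteq> 0\<^sub>v ?n" using v(1) A unfolding eigenvector_def by auto
  \<comment> \<open>A positive value puts the point in the ball, a zero value on its
    boundary.\<close>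
  have "0 < H_form p q v \<or> H_form p q v = 0"
    using pos unfolding H_form_sgn_sum[OF vc(1)] by (auto simp: less_complex_def simp del: of_real_sum)
  then have "proj_pt v \<in> closed_gen_ball p q"
    using vc unfolding closed_gen_ball_def gen_ball_def gen_ball_boundary_def by blast
  moreover have "proj_pt v \<in> fixed_points A" using v unfolding fixed_points_def by blast
  ultimately show ?thesis by blast
qed

end
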